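(* The equivalence relation generated by sliced reorderings is strictly contained in reads-from equivalence: one always has $(\rightsquigarrow_s \cup \rightsquigarrow_s^{-1})^* \subseteq\ \equiv_{\mathsf{rf}}$, and there exist finite sets $\mathcal{T}$ of threads and $\mathcal{X}$ of memory locations, and runs $\sigma,\rho$ over the corresponding alphabet, such that $\sigma \equiv_{\mathsf{rf}} \rho$ but $(\sigma,\rho)\notin (\rightsquigarrow_s \cup \rightsquigarrow_s^{-1})^*$. Here $(\cdot)^*$ denotes reflexive transitive closure.
   Context: Given finite sets $\mathcal{T}$ (threads) and $\mathcal{X}$ (memory locations), let $\Sigma=\{\langle t,op(x)\rangle : t\in\mathcal{T},\ op\in\{\mathtt{w},\mathtt{r}\},\ x\in\mathcal{X}\}$ ($\mathtt{w}$ = write, $\mathtt{r}$ = read). A run is a finite word $\sigma\in\Sigma^*$; the occurrences of letters in it are its events. The reads-from map $\mathsf{rf}_\sigma$ is the partial map sending each read event on a location $x$ to the last write event on $x$ preceding it in $\sigma$, undefined if there is no such write. Reads-from equivalence: $\sigma\equiv_{\mathsf{rf}}\rho$ iff for every thread $t$ the subsequence of events of thread $t$ is the same in $\sigma$ and $\rho$ (same events and same program order; so the $j$-th event of thread $t$ in $\sigma$ is identified with the $j$-th event of thread $t$ in $\rho$), and, under this identification, $\mathsf{rf}_\sigma=\mathsf{rf}_\rho$. Sliced reordering: $\sigma\rightsquigarrow_s\rho$ iff $\sigma\equiv_{\mathsf{rf}}\rho$ and the events of $\sigma$ can be partitioned into two disjoint (possibly empty) subsequences $\sigma_1,\sigma_2$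 of $\sigma$ such that $\rho=\sigma_1\cdot\sigma_2$ as sequences of events (identifying, for every thread $t$ and every $j$, the $j$-th event of thread $t$ in $\sigma$ with the $j$-th event of thread $t$ in $\rho$). *)

theory Defs
  imports Main
begin

datatype 'x operation = Write 'x | Read 'x

type_synonym ('t, 'x) letter = "'t \<times> 'x operation"

definition alphabet :: "'t set \<Rightarrow> 'x set \<Rightarrow> ('t, 'x) letter set" where
  "alphabet T X = T \<times> (Write ` X \<union> Read ` X)"

definition runs :: "'t set \<Rightarrow> 'x set \<Rightarrow> ('t, 'x) letter list set" where
  "runs T X = lists (alphabet T X)"

definition thread_proj :: "'t \<Rightarrow> ('t, 'x) letter list \<Rightarrow> ('t, 'x) letter list" where
  "thread_proj t \<sigma> = filter (\<lambda>a. fst a = t) \<sigma>"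

text \<open>
  The events of a run are its positions. To compare events of different runs, position
  \<open>i\<close> is given the identity \<open>(t, j)\<close>: it is the \<open>j\<close>-th event (counting from 0) of thread \<open>t\<close>.
\<close>

definition event_id :: "('t, 'x) letter list \<Rightarrow> nat \<Rightarrow> 't \<times> nat" where
  "event_id \<sigma> i = (fst (\<sigma> ! i), card {k. k < i \<and> fst (\<sigma> ! k) = fst (\<sigma> ! i)})"

definition event_seq :: "('t, 'x) letter list \<Rightarrow> ('t \<times> nat) list" where
  "event_seq \<sigma> = map (event_id \<sigma>) [0..<length \<sigma>]"

definition writes_before :: "('t, 'x) letter list \<Rightarrow> nat \<Rightarrow> 'x \<Rightarrow> nat set" where
  "writes_before \<sigma> i x = {j. j < i \<and> snd (\<sigma> ! j) = Write x}"

definition reads_from :: "('t, 'x) letter list \<Rightarrow> nat \<rightharpoonup> nat" where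
  "reads_from \<sigma> i =
     (if i < length \<sigma> then
        (case snd (\<sigma> ! i) of
           Write x \<Rightarrow> None
         | Read x \<Rightarrow> if writes_before \<sigma> i x = {} then None else Some (Max (writes_before \<sigma> i x)))
      else None)"

definition same_reads_from :: "('t, 'x) letter list \<Rightarrow> ('t, 'x) letter list \<Rightarrow> bool" where
  "same_reads_from \<sigma> \<rho> \<longleftrightarrow>
     (\<forall>i < length \<sigma>. \<forall>j < length \<rho>. event_id \<sigma> i = event_id \<rho> j \<longrightarrow>
        map_option (event_id \<sigma>) (reads_from \<sigma> i) = map_option (event_id \<rho>) (reads_from \<rho> j))"

definition rf_equiv :: "'t set \<Rightarrow> 'x set \<Rightarrow> ('t, 'x) letter list rel" where
  "rf_equiv T X =
     {(\<sigma>, \<rho>). \<sigma> \<in> runs T X \<and> \<rho> \<in> runs T X \<and>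
        (\<forall>t. thread_proj t \<sigma> = thread_proj t \<rho>) \<and> same_reads_from \<sigma> \<rho>}"

text \<open>
  The two subsequences of \<open>\<sigma>\<close> are those at the positions in \<open>A\<close> and outside \<open>A\<close>. Equating
  sequences of event identities, rather than of letters, matters because one letter may
  occur several times in a run.
\<close>

definition sliced :: "'t set \<Rightarrow> 'x set \<Rightarrow> ('t, 'x) letter list rel" where
  "sliced T X =
     {(\<sigma>, \<rho>). (\<sigma>, \<rho>) \<in> rf_equiv T X \<and>
        (\<exists>A. event_seq \<rho> = nths (event_seq \<sigma>) A @ nths (event_seq \<sigma>) (- A))}"

end

theory Submission
  imports Defs
begin

text \<open>
  A sliced reordering has at most one descent: no target can contain
  \<open>v' < u' < v < u\<close> where the source has \<open>u' < v'\<close> and \<open>u < v\<close>. In the counterexample every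
  location is written twice, so a run has to order two blocks (a write with its reads) per
  location. Program order ties the three choices together in a cycle of implications, hence
  a run of the equivalence class makes all of them in the one way or all in the other way.
  Two further program order edges create the forbidden pattern between any two runs that
  choose differently, in either direction.
\<close>

section \<open>Events\<close>

lemma event_id_eq:
  assumes "i < length \<sigma>"
  shows "event_id \<sigma> i = (fst (\<sigma> ! i), length (thread_proj (fst (\<sigma> ! i)) (take i \<sigma>)))"
proof -
  have "{k. k < length (take i \<sigma>) \<and> fst (take i \<sigma> ! k) = fst (\<sigma> ! i)}
      = {k. k < i \<and> fst (\<sigma> ! k) = fst (\<sigma> ! i)}"
    using assms by auto
  then show ?thesis
    by (simp add: event_id_def thread_proj_def length_filter_conv_card)
qed

text \<open>Split the run at \<open>i\<close>: the prefix contributes exactly \<open>j\<close>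
  letters to the projection, so the letter at \<open>i\<close> lands at index
  \<open>j\<close>.\<close>

lemma thread_proj_nth_event_id:
  assumes "i < length \<sigma>" "event_id \<sigma> i = (t, j)"
  shows "j < length (thread_proj t \<sigma>)" "thread_proj t \<sigma> ! j = \<sigma> ! i"
proof -
  have t: "t = fst (\<sigma> ! i)" and j: "j = length (thread_proj t (take i \<sigma>))"
    using assms by (auto simp: event_id_eq)
  have "thread_proj t \<sigma> = thread_proj t (take i \<sigma> @ \<sigma> ! i # drop (Suc i) \<sigma>)"
    using id_take_nth_drop[OF assms(1)] by simp
  also have "\<dots> = thread_proj t (take i \<sigma>) @ \<sigma> ! i # thread_proj t (drop (Suc i) \<sigma>)"
    by (simp add: thread_proj_def t)
  finally show "j < length (thread_proj t \<sigma>)" "thread_proj t \<sigma> ! j = \<sigma> ! i"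
    by (simp_all add: j)
qed

text \<open>Appending a letter leaves earlier identities unchanged and gives the new event the next
  index of its thread. Together with \<open>thread_proj_nth_event_id\<close>, identities are exactly
  the valid indices into thread projections.\<close>

lemma event_id_exists:
  "j < length (thread_proj t \<sigma>) \<Longrightarrow> \<exists>i < length \<sigma>. event_id \<sigma> i = (t, j)"
proof (induction \<sigma> rule: rev_induct)
  case Nil
  then show ?case by (simp add: thread_proj_def)
next
  case (snoc a \<sigma>)
  show ?case
  proof (cases "j < length (thread_proj t \<sigma>)")
    case True
    then obtain i where "i < length \<sigma>" "event_id \<sigma> i = (t, j)"
      using snoc.IH by blast
    then show ?thesis
      by (intro exI[of _ i]) (auto simp: event_id_eq nth_append)
  next
    case False
    with snoc.prems have "fst a = t" "j = length (thread_proj t \<sigma>)"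
      by (auto simp: thread_proj_def split: if_splits)
    then show ?thesis
      by (intro exI[of _ "length \<sigma>"]) (auto simp: event_id_eq)
  qed
qed

lemma fst_event_id [simp]: "fst (event_id \<sigma> i) = fst (\<sigma> ! i)"
  by (simp add: event_id_def)

lemma snd_event_id_less:
  assumes "i < k" "fst (\<sigma> ! i) = fst (\<sigma> ! k)"
  shows "snd (event_id \<sigma> i) < snd (event_id \<sigma> k)"
  unfolding event_id_def snd_conv
  by (rule psubset_card_mono) (use assms in auto)

lemma event_id_eq_iff [simp]: "event_id \<sigma> i = event_id \<sigma> k \<longleftrightarrow> i = k"
  by (metis fst_event_id less_irrefl linorder_neqE_nat snd_event_id_less)

text \<open>Inverse of \<open>event_id \<tau>\<close>, used to compare where different runs place
  the same event. The value is meaningful only for identities that occur in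
  \<open>\<tau>\<close>.\<close>

definition event_pos :: "('t, 'x) letter list \<Rightarrow> 't \<times> nat \<Rightarrow> nat" where
  "event_pos \<tau> e = (THE i. i < length \<tau> \<and> event_id \<tau> i = e)"

lemma event_pos_event_id [simp]: "i < length \<tau> \<Longrightarrow> event_pos \<tau> (event_id \<tau> i) = i"
  by (auto simp: event_pos_def)

section \<open>Reads-from equivalence\<close>

text \<open>Identities index into the thread projections, and these coincide for equivalent
  runs.\<close>

lemma rf_equiv_event:
  assumes "(\<sigma>, \<tau>) \<in> rf_equiv T X" "i < length \<sigma>"
  shows "\<exists>k < length \<tau>. event_id \<tau> k = event_id \<sigma> i \<and> \<tau> ! k = \<sigma> ! i"
proof -
  obtain t j where e: "event_id \<sigma> i = (t, j)" by (meson surj_pair)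
  have eq: "thread_proj t \<sigma> = thread_proj t \<tau>"
    using assms(1) unfolding rf_equiv_def by blast
  note * = thread_proj_nth_event_id[OF assms(2) e, unfolded eq]
  from event_id_exists[OF *(1)] obtain k where k: "k < length \<tau>" "event_id \<tau> k = (t, j)"
    by blast
  show ?thesis
    using k e *(2) thread_proj_nth_event_id(2)[OF k] by auto
qed

lemma rf_equiv_reads_from:
  assumes "(\<sigma>, \<rho>) \<in> rf_equiv T X" "i < length \<sigma>" "j < length \<rho>" "event_id \<sigma> i = event_id \<rho> j"
  shows "map_option (event_id \<sigma>) (reads_from \<sigma> i) = map_option (event_id \<rho>) (reads_from \<rho> j)"
  using assms by (simp add: rf_equiv_def same_reads_from_def)

lemma rf_equiv_refl: "\<sigma> \<in> runs T X \<Longrightarrow> (\<sigma>, \<sigma>) \<in> rf_equiv T X"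
  by (simp add: rf_equiv_def same_reads_from_def)

lemma rf_equiv_sym: "(\<sigma>, \<rho>) \<in> rf_equiv T X \<Longrightarrow> (\<rho>, \<sigma>) \<in> rf_equiv T X"
  by (auto simp: rf_equiv_def same_reads_from_def)

lemma rf_equiv_trans:
  assumes "(\<sigma>, \<tau>) \<in> rf_equiv T X" "(\<tau>, \<rho>) \<in> rf_equiv T X"
  shows "(\<sigma>, \<rho>) \<in> rf_equiv T X"
proof -
  have "same_reads_from \<sigma> \<rho>"
    unfolding same_reads_from_def
  proof (intro allI impI)
    fix i j
    assume "i < length \<sigma>" "j < length \<rho>" "event_id \<sigma> i = event_id \<rho> j"
    \<comment> \<open>The middle run contains the same event, so the two equalities of sources
      compose at \<open>k\<close>.\<close>
    moreover obtain k where "k < length \<tau>" "event_id \<tau> k = event_id \<sigma> i"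
      using rf_equiv_event[OF assms(1) \<open>i < length \<sigma>\<close>] by blast
    ultimately show "map_option (event_id \<sigma>) (reads_from \<sigma> i) = map_option (event_id \<rho>) (reads_from \<rho> j)"
      using rf_equiv_reads_from[OF assms(1), of i k] rf_equiv_reads_from[OF assms(2), of k j] by simp
  qed
  with assms show ?thesis
    by (simp add: rf_equiv_def)
qed

lemma sliced_closure_subset_rf_equiv:
  assumes "(\<sigma>, \<rho>) \<in> (sliced T X \<union> (sliced T X)\<inverse>)\<^sup>*" "\<sigma> \<in> runs T X"
  shows "(\<sigma>, \<rho>) \<in> rf_equiv T X"
  using assms(1)
proof (induction rule: rtrancl_induct)
  case base
  then show ?case using assms(2) by (rule rf_equiv_refl)
next
  case (step \<tau> \<rho>)
  then have "(\<tau>, \<rho>) \<in> rf_equiv T X"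
    by (auto simp: sliced_def intro: rf_equiv_sym)
  with step.IH show ?case by (rule rf_equiv_trans)
qed

section \<open>Order constraints shared by all runs of an equivalence class\<close>

context
  fixes \<sigma> \<tau> :: "('t, 'x) letter list" and T X
  assumes eqv: "(\<sigma>, \<tau>) \<in> rf_equiv T X"
begin

lemma event_pos_rf_equiv:
  assumes "i < length \<sigma>"
  shows "event_pos \<tau> (event_id \<sigma> i) < length \<tau>"
    and "event_id \<tau> (event_pos \<tau> (event_id \<sigma> i)) = event_id \<sigma> i"
    and "\<tau> ! event_pos \<tau> (event_id \<sigma> i) = \<sigma> ! i"
proof -
  obtain k where k: "k < length \<tau>" "event_id \<tau> k = event_id \<sigma> i" "\<tau> ! k = \<sigma> ! i"
    using rf_equiv_event[OF eqv assms] by blast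
  then have "event_pos \<tau> (event_id \<sigma> i) = k"
    using event_pos_event_id[of k \<tau>] by simp
  with k show "event_pos \<tau> (event_id \<sigma> i) < length \<tau>"
    and "event_id \<tau> (event_pos \<tau> (event_id \<sigma> i)) = event_id \<sigma> i"
    and "\<tau> ! event_pos \<tau> (event_id \<sigma> i) = \<sigma> ! i" by auto
qed

text \<open>Within a thread, positions are ordered as the indices in the identities, and these do
  not depend on the run.\<close>

lemma program_order_preserved:
  assumes "i < k" "k < length \<sigma>" "fst (\<sigma> ! i) = fst (\<sigma> ! k)"
  shows "event_pos \<tau> (event_id \<sigma> i) < event_pos \<tau> (event_id \<sigma> k)"
proof (rule ccontr)
  let ?i = "event_pos \<tau> (event_id \<sigma> i)" and ?k = "event_pos \<tau> (event_id \<sigma> k)"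
  note i = event_pos_rf_equiv[of i] and k = event_pos_rf_equiv[of k]
  assume "\<not> ?i < ?k"
  moreover have "event_id \<tau> ?i \<noteq> event_id \<tau> ?k" using i(2) k(2) assms by simp
  then have "?i \<noteq> ?k" by metis
  ultimately have "snd (event_id \<tau> ?k) < snd (event_id \<tau> ?i)"
    using i k assms by (intro snd_event_id_less) auto
  moreover have "snd (event_id \<sigma> i) < snd (event_id \<sigma> k)"
    using assms by (intro snd_event_id_less) auto
  ultimately show False using i k assms by simp
qed

text \<open>The read still takes its value from \<open>j\<close> in \<open>\<tau>\<close>, and its
  source is the last write to \<open>x\<close> before it. Hence no competing write can lie between
  the two.\<close>

lemma writes_outside_block:
  assumes "i < length \<sigma>" "snd (\<sigma> ! i) = Read x" "reads_from \<sigma> i = Some j"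
    and "j < length \<sigma>" "k < length \<sigma>" "snd (\<sigma> ! k) = Write x" "k \<noteq> j"
  shows "event_pos \<tau> (event_id \<sigma> j) < event_pos \<tau> (event_id \<sigma> i)"
    and "event_pos \<tau> (event_id \<sigma> k) < event_pos \<tau> (event_id \<sigma> j) \<or>
         event_pos \<tau> (event_id \<sigma> i) < event_pos \<tau> (event_id \<sigma> k)"
proof -
  let ?i = "event_pos \<tau> (event_id \<sigma> i)" and ?k = "event_pos \<tau> (event_id \<sigma> k)"
  let ?j = "event_pos \<tau> (event_id \<sigma> j)"
  note i = event_pos_rf_equiv[OF assms(1)] and j = event_pos_rf_equiv[OF assms(4)]
    and k = event_pos_rf_equiv[OF assms(5)]
  have "map_option (event_id \<tau>) (reads_from \<tau> ?i) = Some (event_id \<sigma> j)"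
    using rf_equiv_reads_from[OF eqv assms(1) i(1)] i(2) assms(3) by simp
  then obtain l where l: "reads_from \<tau> ?i = Some l" "event_id \<tau> l = event_id \<tau> ?j"
    unfolding j(2) map_option_eq_Some by blast
  from l(2) have "l = ?j" by (rule iffD1[OF event_id_eq_iff])
  with l(1) have "reads_from \<tau> ?i = Some ?j" by argo
  then have ne: "writes_before \<tau> ?i x \<noteq> {}" and max: "Max (writes_before \<tau> ?i x) = ?j"
    using i assms(2) by (auto simp: reads_from_def split: if_splits)
  have fin: "finite (writes_before \<tau> ?i x)"
    by (simp add: writes_before_def)
  from Max_in[OF fin ne] max show "?j < ?i"
    by (simp add: writes_before_def)
  have "event_id \<tau> ?k \<noteq> event_id \<tau> ?j" using j(2) k(2) assms(7) by simp
  then have "?k \<noteq> ?j" by metis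
  moreover have "?k \<noteq> ?i" using i(3) k(3) assms(2,6) by auto
  moreover have "?k \<le> ?j" if "?k < ?i"
  proof -
    have "?k \<in> writes_before \<tau> ?i x"
      using that k(3) assms(6) by (simp add: writes_before_def)
    then show ?thesis using Max_ge[OF fin] max by simp
  qed
  ultimately show "?k < ?j \<or> ?i < ?k" by linarith
qed

end

section \<open>Sliced reorderings\<close>

lemma sorted_wrt_nths: "sorted_wrt P xs \<Longrightarrow> sorted_wrt P (nths xs A)"
  by (induction xs arbitrary: A) (auto simp: nths_Cons dest: in_set_nthsD)

text \<open>The number \<open>m\<close> is the length of the first slice.\<close>

lemma sliced_threshold:
  assumes "(\<sigma>, \<rho>) \<in> sliced T X"
  obtains m where
    "\<And>i k. \<lbrakk>i < k; k < length \<rho>; k < m \<or> m \<le> i\<rbrakk>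
       \<Longrightarrow> event_pos \<sigma> (event_id \<rho> i) < event_pos \<sigma> (event_id \<rho> k)"
proof -
  let ?P = "\<lambda>e f. event_pos \<sigma> e < event_pos \<sigma> f"
  obtain A where A: "event_seq \<rho> = nths (event_seq \<sigma>) A @ nths (event_seq \<sigma>) (- A)"
    using assms by (auto simp: sliced_def)
  let ?m = "length (nths (event_seq \<sigma>) A)"
  \<comment> \<open>A run lists its own events by increasing position, and each slice inherits this
    as a subsequence.\<close>
  have "sorted_wrt ?P (event_seq \<sigma>)"
    by (simp add: event_seq_def sorted_wrt_iff_nth_less)
  then have 1: "sorted_wrt ?P (nths (event_seq \<sigma>) A)" "sorted_wrt ?P (nths (event_seq \<sigma>) (- A))"
    by (simp_all add: sorted_wrt_nths)
  have len: "length (event_seq \<rho>) = length \<rho>" and nth: "\<And>i. i < length \<rho> \<Longrightarrow> event_seq \<rho> ! i = event_id \<rho> i"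
    by (simp_all add: event_seq_def)
  have "?P (event_id \<rho> i) (event_id \<rho> k)"
    if "i < k" "k < length \<rho>" "k < ?m \<or> ?m \<le> i" for i k
  proof (cases "k < ?m")
    case True
    then have "?P (nths (event_seq \<sigma>) A ! i) (nths (event_seq \<sigma>) A ! k)"
      using 1(1) \<open>i < k\<close> sorted_wrt_nth_less by blast
    then show ?thesis
      using True that(1,2) nth[of i] nth[of k] by (simp add: A nth_append)
  next
    case False
    have "length \<rho> = ?m + length (nths (event_seq \<sigma>) (- A))"
      using len A by simp
    then have "?P (nths (event_seq \<sigma>) (- A) ! (i - ?m)) (nths (event_seq \<sigma>) (- A) ! (k - ?m))"
      using that False by (intro sorted_wrt_nth_less[OF 1(2)]) auto
    then show ?thesis
      using False that nth[of i] nth[of k] by (simp add: A nth_append)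
  qed
  then show ?thesis by (rule that)
qed

text \<open>An inverted pair must straddle the boundary \<open>m\<close> between the slices. Two
  inverted pairs, one entirely before the other, would need the boundary in two places.\<close>

lemma no_two_descents:
  assumes "(\<sigma>, \<rho>) \<in> sliced T X"
    and "{v', u', v, u} \<subseteq> event_id \<rho> ` {..<length \<rho>}"
    and "event_pos \<rho> v' < event_pos \<rho> u'" "event_pos \<rho> u' < event_pos \<rho> v"
      "event_pos \<rho> v < event_pos \<rho> u"
    and "event_pos \<sigma> u' < event_pos \<sigma> v'" "event_pos \<sigma> u < event_pos \<sigma> v"
  shows False
proof -
  obtain m where m: "\<And>i k. \<lbrakk>i < k; k < length \<rho>; k < m \<or> m \<le> i\<rbrakk>
       \<Longrightarrow> event_pos \<sigma> (event_id \<rho> i) < event_pos \<sigma> (event_id \<rho> k)"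
    using sliced_threshold[OF assms(1)] by blast
  obtain a b c d where eqs: "v' = event_id \<rho> a" "u' = event_id \<rho> b" "v = event_id \<rho> c" "u = event_id \<rho> d"
    and "a < length \<rho>" "b < length \<rho>" "c < length \<rho>" "d < length \<rho>"
    using assms(2) by auto
  with assms(3-5) have "a < b" "b < c" "c < d" by simp_all
  then show False
    using m[of a b] m[of c d] assms(6,7) \<open>b < length \<rho>\<close> \<open>d < length \<rho>\<close>
    unfolding eqs by linarith
qed

section \<open>The counterexample\<close>

text \<open>
  Positions refer to \<open>run1\<close>: the competing writes are 5 and 8 (location 0), 0 and 4
  (location 1), 1 and 10 (location 2). The two further program order edges of the opening
  paragraph are 1 before 8 and 4 before 5.
\<close>

definition run1 :: "(nat, nat) letter list" where
  "run1 = [(5, Write 1), (2, Write 2), (3, Read 2), (3, Read 1), (0, Write 1), (0, Write 0),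
     (5, Read 0), (0, Read 2), (2, Write 0), (2, Read 1), (4, Write 2), (4, Read 0),
     (1, Read 1), (1, Read 2)]"

text \<open>Here all three choices are reversed: event 8 precedes 5, event 4 precedes 0 and event 10
  precedes 1.\<close>

definition run2 :: "(nat, nat) letter list" where
  "run2 = [(0, Write 1), (4, Write 2), (1, Read 1), (1, Read 2), (2, Write 2), (2, Write 0),
     (4, Read 0), (2, Read 1), (0, Write 0), (0, Read 2), (5, Write 1), (5, Read 0),
     (3, Read 2), (3, Read 1)]"

lemma run1_length [simp]: "length run1 = 14"
  by (simp add: run1_def)

text \<open>This and the next two code equations range over finite lists, so that
  \<open>code_simp\<close> can evaluate the concrete runs.\<close>

lemma event_id_code [code]:
  "event_id \<sigma> i = (let t = fst (\<sigma> ! i) in (t, length (filter (\<lambda>k. fst (\<sigma> ! k) = t) [0..<i])))"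
  by (simp add: event_id_def Let_def length_filter_conv_card cong: conj_cong)

lemma writes_before_code [code]:
  "writes_before \<sigma> i x = set (filter (\<lambda>j. snd (\<sigma> ! j) = Write x) [0..<i])"
  by (auto simp: writes_before_def)

lemma same_reads_from_code [code]:
  "same_reads_from \<sigma> \<rho> \<longleftrightarrow>
     (\<forall>i \<in> set [0..<length \<sigma>]. \<forall>j \<in> set [0..<length \<rho>]. event_id \<sigma> i = event_id \<rho> j \<longrightarrow>
        map_option (event_id \<sigma>) (reads_from \<sigma> i) = map_option (event_id \<rho>) (reads_from \<rho> j))"
  by (auto simp: same_reads_from_def)

lemma same_reads_from_run1_run2: "same_reads_from run1 run2"
  by code_simp

lemma reads_from_run1:
  "map (reads_from run1) [0..<14] =
     [None, None, Some 1, Some 0, None, None, Some 5, Some 1, None, Some 4, None, Some 8, Some 4, Some 10]"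
  by code_simp

lemma rf_equiv_run1_run2: "(run1, run2) \<in> rf_equiv {0..5} {0..2}"
  using same_reads_from_run1_run2
  by (auto simp: rf_equiv_def runs_def alphabet_def thread_proj_def run1_def run2_def)

text \<open>The cycle of implications: \<open>q 5 < q 8\<close> gives
  \<open>q 0 < q 6 < q 8 < q 9\<close>, hence \<open>q 0 < q 4\<close>. This gives
  \<open>q 1 < q 2 < q 3 < q 4 < q 12 < q 13\<close>, hence \<open>q 1 < q 10\<close>. This gives
  \<open>q 5 < q 7 < q 10 < q 11\<close>, hence \<open>q 5 < q 8\<close> again.\<close>

lemma rf_equiv_run1_order:
  fixes q :: "nat \<Rightarrow> nat"
  assumes eqv: "(run1, \<tau>) \<in> rf_equiv T X"
  defines "q \<equiv> \<lambda>i. event_pos \<tau> (event_id run1 i)"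
  shows "q 1 < q 8" "q 4 < q 5"
    and "q 5 < q 8 \<and> q 0 < q 4 \<and> q 1 < q 10 \<or> q 8 < q 5 \<and> q 4 < q 0 \<and> q 10 < q 1"
proof -
  have po: "q i < q k" if "i < k" "k < 14" "fst (run1 ! i) = fst (run1 ! k)" for i k
    using program_order_preserved[OF eqv] that by (simp add: q_def)
  have rf: "q j < q i" "q k < q j \<or> q i < q k"
    if "i < 14" "snd (run1 ! i) = Read x" "map (reads_from run1) [0..<14] ! i = Some j"
      "j < 14" "k < 14" "snd (run1 ! k) = Write x" "k \<noteq> j" for i j k x
    using writes_outside_block[OF eqv, of i x j k] that by (simp_all add: q_def)
  note rf = rf[unfolded reads_from_run1]
  show "q 1 < q 8" "q 4 < q 5"
    by (rule po; simp add: run1_def)+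
  have "q 5 < q 7" "q 4 < q 7" "q 12 < q 13" "q 1 < q 9" "q 8 < q 9" "q 2 < q 3" "q 10 < q 11" "q 0 < q 6"
    by (rule po; simp add: run1_def)+
  \<comment> \<open>The arguments of \<open>rf\<close> are a read, its location, the write it reads
    from and the competing write.\<close>
  moreover have "q 0 < q 3" "q 1 < q 2" "q 1 < q 7" "q 4 < q 9" "q 4 < q 12" "q 5 < q 6" "q 8 < q 11" "q 10 < q 13"
    using rf(1)[of 3 1 0 4] rf(1)[of 2 2 1 10] rf(1)[of 7 2 1 10] rf(1)[of 9 1 4 0]
      rf(1)[of 12 1 4 0] rf(1)[of 6 0 5 8] rf(1)[of 11 0 8 5] rf(1)[of 13 2 10 1]
    by (simp_all add: run1_def)
  moreover have "q 4 < q 0 \<or> q 3 < q 4" "q 10 < q 1 \<or> q 2 < q 10" "q 10 < q 1 \<or> q 7 < q 10"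
    "q 0 < q 4 \<or> q 9 < q 0" "q 0 < q 4 \<or> q 12 < q 0" "q 8 < q 5 \<or> q 6 < q 8"
    "q 5 < q 8 \<or> q 11 < q 5" "q 1 < q 10 \<or> q 13 < q 1"
    using rf(2)[of 3 1 0 4] rf(2)[of 2 2 1 10] rf(2)[of 7 2 1 10] rf(2)[of 9 1 4 0]
      rf(2)[of 12 1 4 0] rf(2)[of 6 0 5 8] rf(2)[of 11 0 8 5] rf(2)[of 13 2 10 1]
    by (simp_all add: run1_def)
  ultimately show "q 5 < q 8 \<and> q 0 < q 4 \<and> q 1 < q 10 \<or> q 8 < q 5 \<and> q 4 < q 0 \<and> q 10 < q 1"
    by linarith
qed

text \<open>The choice at location 0, which by \<open>rf_equiv_run1_order\<close> determines the
  other two.\<close>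

definition early :: "(nat, nat) letter list \<Rightarrow> bool" where
  "early \<tau> \<longleftrightarrow> event_pos \<tau> (event_id run1 5) < event_pos \<tau> (event_id run1 8)"

lemma sliced_early_iff:
  assumes "(run1, \<sigma>) \<in> rf_equiv T X" "(\<sigma>, \<rho>) \<in> sliced T X"
  shows "early \<sigma> \<longleftrightarrow> early \<rho>"
proof -
  define p q where pq: "p i = event_pos \<sigma> (event_id run1 i)" "q i = event_pos \<rho> (event_id run1 i)" for i
  have \<rho>: "(run1, \<rho>) \<in> rf_equiv T X"
    using assms by (auto simp: sliced_def intro: rf_equiv_trans)
  note ord = rf_equiv_run1_order[OF assms(1), folded pq] rf_equiv_run1_order[OF \<rho>, folded pq]
  have "event_id run1 i \<in> event_id \<rho> ` {..<length \<rho>}" if "i < 14" for i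
    using event_pos_rf_equiv(1,2)[OF \<rho>, of i] that
    by (metis (no_types, lifting) imageI lessThan_iff run1_length)
  then have False if "a < 14" "b < 14" "c < 14" "d < 14"
      "q a < q b" "q b < q c" "q c < q d" "p b < p a" "p d < p c" for a b c d
    using no_two_descents[OF assms(2), of "event_id run1 a" "event_id run1 b" "event_id run1 c" "event_id run1 d"]
      that by (simp add: pq)
  \<comment> \<open>The first instance excludes going from early to late: 10, 1, 8, 5 occur in this
    order in \<open>\<rho>\<close>, with 1 before 8 by program order. The second, with 4 before 5,
    excludes late to early.\<close>
  from this[of 10 1 8 5] this[of 0 4 5 8] ord
  have "p 5 < p 8 \<longleftrightarrow> q 5 < q 8" by auto
  then show ?thesis by (simp add: early_def pq)
qed

lemma sliced_closure_early:
  assumes "(run1, \<rho>) \<in> (sliced T X \<union> (sliced T X)\<inverse>)\<^sup>*" "run1 \<in> runs T X"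
  shows "early \<rho>"
  using assms(1)
proof (induction rule: rtrancl_induct)
  case base
  have "event_pos run1 (event_id run1 i) = i" if "i < 14" for i
    using that by (simp add: run1_def)
  then show ?case by (simp add: early_def)
next
  case (step \<tau> \<rho>)
  \<comment> \<open>Either run may be the source of the sliced step, so both must be equivalent to
    \<open>run1\<close>.\<close>
  have "(run1, \<tau>) \<in> rf_equiv T X" "(run1, \<rho>) \<in> rf_equiv T X"
    using step.hyps assms(2) sliced_closure_subset_rf_equiv rtrancl.rtrancl_into_rtrancl by metis+
  with step show ?case
    using sliced_early_iff by blast
qed

lemma not_early_run2: "\<not> early run2"
proof -
  \<comment> \<open>As identities of \<open>run2\<close>, the two events can be located there by
    \<open>event_pos_event_id\<close>.\<close>
  have "event_id run1 5 = event_id run2 8" "event_id run1 8 = event_id run2 5"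
    by code_simp+
  then show ?thesis
    by (simp add: early_def) (simp add: run2_def)
qed

theorem theorem3p3:
  "(\<forall>(T :: 't set) (X :: 'x set). finite T \<longrightarrow> finite X \<longrightarrow>
      (sliced T X \<union> (sliced T X)\<inverse>)\<^sup>* \<inter> (runs T X \<times> runs T X) \<subseteq> rf_equiv T X) \<and>
   (\<exists>(T :: nat set) (X :: nat set) \<sigma> \<rho>. finite T \<and> finite X \<and>
      \<sigma> \<in> runs T X \<and> \<rho> \<in> runs T X \<and>
      (\<sigma>, \<rho>) \<in> rf_equiv T X \<and> (\<sigma>, \<rho>) \<notin> (sliced T X \<union> (sliced T X)\<inverse>)\<^sup>*)"
proof (intro conjI)
  show "\<forall>(T :: 't set) (X :: 'x set). finite T \<longrightarrow> finite X \<longrightarrow>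
      (sliced T X \<union> (sliced T X)\<inverse>)\<^sup>* \<inter> (runs T X \<times> runs T X) \<subseteq> rf_equiv T X"
    by (auto intro: sliced_closure_subset_rf_equiv)
  let ?T = "{0..5} :: nat set" and ?X = "{0..2} :: nat set"
  have "run1 \<in> runs ?T ?X" "run2 \<in> runs ?T ?X"
    using rf_equiv_run1_run2 by (auto simp: rf_equiv_def)
  moreover from this have "(run1, run2) \<notin> (sliced ?T ?X \<union> (sliced ?T ?X)\<inverse>)\<^sup>*"
    using sliced_closure_early not_early_run2 by blast
  ultimately show "\<exists>(T :: nat set) (X :: nat set) \<sigma> \<rho>. finite T \<and> finite X \<and>
      \<sigma> \<in> runs T X \<and> \<rho> \<in> runs T X \<and>
      (\<sigma>, \<rho>) \<in> rf_equiv T X \<and> (\<sigma>, \<rho>) \<notin> (sliced T X \<union> (sliced T X)\<inverse>)\<^sup>*"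
    using rf_equiv_run1_run2 by blast
qed

end
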